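(* Let $\mu$ be a probability measure on $\mathbb{R}^n$ with compact support. Suppose that for some $c>0$ the following strong hypercontractivity property holds: for all $0<p\le q<\infty$ and all log-subharmonic $f\in L^p(\mu)$, $$\|f_{e^{-t}}\|_{q,\mu}\le\|f\|_{p,\mu}\quad\text{for } t\ge c\cdot\tfrac12\log\tfrac{q}{p},$$ where $f_s(x)=f(sx)$. Then for every log-subharmonic function $f\in\mathcal{C}^1(\mathbb{R}^n)$ the following logarithmic Sobolev inequality holds: $$\int f^2\log f^2\,d\mu-\|f\|_{2,\mu}^2\log\|f\|_{2,\mu}^2\le c\int f\,Ef\,d\mu,$$ where $Ef(x)=x\cdot\nabla f(x)$.
   Context: A function $u:\mathbb{R}^n\to[-\infty,\infty)$ that is upper semicontinuous, locally integrable and not identically $-\infty$ is called subharmonic if for all $x,y\in\mathbb{R}^n$, $u(x)\le\int_{O(n)}u(x+\alpha y)\,d\alpha$, where $d\alpha$ is normalized Haar measure on the orthogonal group $O(n)$. A function $g:\mathbb{R}^n\to[0,\infty)$ is log-subharmonic if $\log g$ is subharmonic (with $\log 0=-\infty$). For $0<p<\infty$, $\|f\|_{p,\mu}=(\int|f|^p\,d\mu)^{1/p}$. The convention $0\log 0=0$ is used. *)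

theory Defs
  imports "HOL-Probability.Probability_Measure"
begin

text \<open>Normalized Haar measure on \<open>O(n)\<close>: the unique Borel probability measure on the group of
  orthogonal matrices that is invariant under left translations.\<close>

definition haar_orthogonal :: "(real ^ 'n ^ 'n) measure" where
  "haar_orthogonal = (THE M. prob_space M
     \<and> sets M = sets (restrict_space borel {A. orthogonal_matrix A})
     \<and> (\<forall>B. orthogonal_matrix B \<longrightarrow> distr M M (\<lambda>A. B ** A) = M))"

text \<open>Integral of an extended-real-valued function as integral of the positive part minus
  integral of the negative part; \<^const>\<open>e2ennreal\<close> maps negative values to \<open>0\<close>.  It is used below only
  for functions that are bounded above and a probability measure, so that the first integral
  is finite and the value lies in \<open>[-\<infinity>,\<infinity>)\<close>.\<close>

definition ereal_integral :: "'a measure \<Rightarrow> ('a \<Rightarrow> ereal) \<Rightarrow> ereal" where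
  "ereal_integral M u =
     enn2ereal (\<integral>\<^sup>+x. e2ennreal (u x) \<partial>M) - enn2ereal (\<integral>\<^sup>+x. e2ennreal (- u x) \<partial>M)"

definition upper_semicontinuous :: "('a::topological_space \<Rightarrow> ereal) \<Rightarrow> bool" where
  "upper_semicontinuous u \<longleftrightarrow> (\<forall>a. open {x. u x < a})"

definition locally_integrable :: "('a::euclidean_space \<Rightarrow> ereal) \<Rightarrow> bool" where
  "locally_integrable u \<longleftrightarrow> u \<in> borel_measurable borel \<and>
     (\<forall>K. compact K \<longrightarrow> (\<integral>\<^sup>+x\<in>K. e2ennreal \<bar>u x\<bar> \<partial>lborel) < \<infinity>)"

definition subharmonic :: "(real ^ 'n \<Rightarrow> ereal) \<Rightarrow> bool" where
  "subharmonic u \<longleftrightarrow> (\<forall>x. u x \<noteq> \<infinity>) \<and> upper_semicontinuous u \<and> locally_integrable u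
     \<and> \<not> (\<forall>x. u x = -\<infinity>)
     \<and> (\<forall>x y. u x \<le> ereal_integral haar_orthogonal (\<lambda>A. u (x + A *v y)))"

definition log_subharmonic :: "(real ^ 'n \<Rightarrow> real) \<Rightarrow> bool" where
  "log_subharmonic g \<longleftrightarrow> (\<forall>x. 0 \<le> g x)
     \<and> subharmonic (\<lambda>x. if g x = 0 then -\<infinity> else ereal (ln (g x)))"

text \<open>\<open>(\<integral>|f|\<^sup>p d\<mu>)\<^sup>1\<^sup>/\<^sup>p\<close> with values in \<open>[0,\<infinity>]\<close>.\<close>

definition Lp_norm :: "'a measure \<Rightarrow> real \<Rightarrow> ('a \<Rightarrow> real) \<Rightarrow> ennreal" where
  "Lp_norm M p f = (let I = (\<integral>\<^sup>+x. ennreal (\<bar>f x\<bar> powr p) \<partial>M) in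
     if I = \<infinity> then \<infinity> else ennreal (enn2real I powr (1 / p)))"

definition in_Lp :: "'a measure \<Rightarrow> real \<Rightarrow> ('a \<Rightarrow> real) \<Rightarrow> bool" where
  "in_Lp M p f \<longleftrightarrow> f \<in> borel_measurable M \<and> Lp_norm M p f < \<infinity>"

definition dilate :: "real \<Rightarrow> ('a::real_vector \<Rightarrow> 'b) \<Rightarrow> 'a \<Rightarrow> 'b" where
  "dilate s f = (\<lambda>x. f (s *\<^sub>R x))"

definition strong_hypercontractive :: "(real ^ 'n) measure \<Rightarrow> real \<Rightarrow> bool" where
  "strong_hypercontractive \<mu> c \<longleftrightarrow>
     (\<forall>p q f. 0 < p \<and> p \<le> q \<and> log_subharmonic f \<and> in_Lp \<mu> p f \<longrightarrow>
        (\<forall>t. t \<ge> c * (1 / 2 * ln (q / p)) \<longrightarrow>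
           Lp_norm \<mu> q (dilate (exp (- t)) f) \<le> Lp_norm \<mu> p f))"

definition measure_support :: "'a::topological_space measure \<Rightarrow> 'a set" where
  "measure_support M = {x. \<forall>U. open U \<longrightarrow> x \<in> U \<longrightarrow> emeasure M U > 0}"

definition gradient :: "('a::real_inner \<Rightarrow> real) \<Rightarrow> 'a \<Rightarrow> 'a" where
  "gradient f x = (THE D. GDERIV f x :> D)"

definition C1 :: "('a::real_inner \<Rightarrow> real) \<Rightarrow> bool" where
  "C1 f \<longleftrightarrow> (\<forall>x. f differentiable at x) \<and> continuous_on UNIV (gradient f)"

definition euler_op :: "('a::real_inner \<Rightarrow> real) \<Rightarrow> 'a \<Rightarrow> real" where
  "euler_op f x = x \<bullet> gradient f x"

end

theory Submission
  imports Defs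
begin

text \<open>Apply hypercontractivity with \<open>p = 2\<close>, \<open>t > 0\<close> and the critical exponent
  \<open>q(t) = 2 exp (2t/c)\<close>, in the form
  \<open>\<integral> f(exp (-t) x) powr q(t) d\<mu> \<le> (\<integral> f\<^sup>2 d\<mu>) powr (q(t)/2)\<close>, which is an equality
  at \<open>t = 0\<close>.  Comparing the right derivatives at \<open>0\<close> gives the inequality.  On the left only a
  lower bound for the derivative is needed, and \<open>powr_ge_tangent\<close> supplies one that is linear in
  \<open>f(exp (-t) x) - f(x)\<close>; hence zeros of \<open>f\<close> cause no trouble, and dominated
  convergence applies because \<open>f\<close> is Lipschitz on balls.\<close>

section \<open>Tangent-line and growth bounds for powers and logarithms\<close>

lemma powr_ge_tangent_base:
  fixes u v q :: real
  assumes "u \<ge> 0" "v \<ge> 0" "q \<ge> 1"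
  shows "v powr q + q * v powr (q - 1) * (u - v) \<le> u powr q"
proof (cases "u = 0 \<or> v = 0")
  \<comment> \<open>Zeros lie outside the open half-line where the convexity bound is applied. For
    \<open>u = 0\<close> the left side is \<open>(1 - q) * v powr q\<close>; for
    \<open>v = 0\<close> it vanishes, since \<open>0 powr a = 0\<close> for every \<open>a\<close>,
    even \<open>a = 0\<close>.\<close>
  case True
  have "v powr q \<le> q * v powr q"
    using assms(3) by (simp add: mult_le_cancel_right1)
  moreover have "v powr (q - 1) * v = v powr q"
    using assms by (cases "v = 0") (simp_all add: powr_diff)
  ultimately show ?thesis
    using True by (auto simp: mult.assoc)
next
  case False
  have "u powr q - v powr q \<ge> q * v powr (q - 1) * (u - v)"
  proof (rule convex_on_imp_above_tangent[where A = "{0<..}"])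
    show "convex_on {0<..} (\<lambda>x. x powr q)"
      by (rule powr_convex) fact
    show "((\<lambda>x. x powr q) has_real_derivative q * v powr (q - 1)) (at v within {0<..})"
      using False assms by (auto intro!: derivative_eq_intros)
  qed (use False assms in \<open>auto simp: interior_open\<close>)
  then show ?thesis by simp
qed

text \<open>Two tangent bounds are chained: convexity of \<open>x powr q\<close> in the base at
  \<open>v\<close>, then \<open>1 + s \<le> exp s\<close> in the exponent at \<open>2\<close>. Both
  sides agree at \<open>u = v\<close>, \<open>q = 2\<close>.\<close>

lemma powr_ge_tangent:
  fixes u v q :: real
  assumes "u \<ge> 0" "v \<ge> 0" "q \<ge> 2"
  shows "v\<^sup>2 + (q - 2) * (v\<^sup>2 * ln v) + q * (v powr (q - 1) * (u - v)) \<le> u powr q"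
proof -
  have "v\<^sup>2 + (q - 2) * (v\<^sup>2 * ln v) \<le> v powr q"
  proof (cases "v = 0")
    case False
    then have "v powr q = v\<^sup>2 * exp ((q - 2) * ln v)"
      using assms(2) by (simp add: powr_def algebra_simps exp_diff flip: powr_numeral)
    moreover have "v\<^sup>2 * (1 + (q - 2) * ln v) \<le> v\<^sup>2 * exp ((q - 2) * ln v)"
      by (intro mult_left_mono exp_ge_add_one_self) simp
    ultimately show ?thesis
      by (simp add: algebra_simps)
  qed simp
  with powr_ge_tangent_base[OF assms(1,2), of q] assms(3) show ?thesis
    by (simp add: mult.assoc)
qed

text \<open>Gives a constant bound for \<open>f\<^sup>2 * ln f\<close> that survives near zeros of
  \<open>f\<close>: \<open>ln v \<le> v - 1\<close>, applied to \<open>v\<close> and to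
  \<open>1 / v\<close>, controls \<open>v * ln v\<close> from both sides.\<close>

lemma abs_square_mult_ln_le:
  fixes v M :: real
  assumes "0 \<le> v" "v \<le> M" "1 \<le> M"
  shows "\<bar>v\<^sup>2 * ln v\<bar> \<le> M ^ 3"
proof (cases "v = 0")
  case False
  then have v: "v > 0" using assms by simp
  have "\<bar>v * ln v\<bar> \<le> M\<^sup>2"
  proof (rule abs_leI)
    have "v * ln v \<le> v * v"
      using v ln_le_minus_one[OF v] by (intro mult_left_mono) auto
    also have "\<dots> \<le> M\<^sup>2"
      using assms v by (simp add: power2_eq_square mult_mono)
    finally show "v * ln v \<le> M\<^sup>2" .
    have "- ln v \<le> 1 / v"
      using ln_le_minus_one[of "1 / v"] v by (simp add: ln_div)
    then have "- (v * ln v) \<le> 1"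
      using v by (simp add: field_simps)
    also have "1 \<le> M\<^sup>2"
      using assms by simp
    finally show "- (v * ln v) \<le> M\<^sup>2" .
  qed
  then have "v * \<bar>v * ln v\<bar> \<le> M * M\<^sup>2"
    using assms v by (intro mult_mono) auto
  then show ?thesis
    using v by (simp add: abs_mult power2_eq_square power3_eq_cube mult.assoc)
qed (use assms in simp)

section \<open>Support, gradient and dilation\<close>

text \<open>The complement of the support is the union of all open null sets; by Lindelof countably
  many of them already cover it.\<close>

lemma AE_measure_support:
  fixes M :: "'a::second_countable_topology measure"
  assumes "sets M = sets borel"
  shows "AE x in M. x \<in> measure_support M"
proof -
  let ?F = "{U. open U \<and> emeasure M U = 0}"
  obtain G where G: "G \<subseteq> ?F" "countable G" "\<Union>G = \<Union>?F"
    using Lindelof[of ?F] by auto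
  have eq: "- measure_support M = \<Union>G"
    unfolding G(3) measure_support_def by (auto simp: not_gr_zero)
  have "(\<Union>U\<in>G. U) \<in> null_sets M"
    using G assms by (intro null_sets_UN') (auto simp: null_sets_def)
  then show ?thesis
    using eq by (intro AE_I'[of "\<Union>G"]) auto
qed

text \<open>Since \<open>gradient\<close> is a definite description, existence and uniqueness are
  both needed. The vector representing the derivative is assembled from its values on the
  basis.\<close>

lemma GDERIV_gradient:
  fixes f :: "'a::euclidean_space \<Rightarrow> real"
  assumes "f differentiable at x"
  shows "GDERIV f x :> gradient f x"
proof -
  obtain f' where f': "(f has_derivative f') (at x)"
    using assms by (auto simp: differentiable_def)
  interpret linear f' using f' by (rule has_derivative_linear)
  define D where "D = (\<Sum>b\<in>Basis. f' b *\<^sub>R b)"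
  have f'_eq: "f' = (\<lambda>h. h \<bullet> D)"
  proof
    fix h
    have "f' h = f' (\<Sum>b\<in>Basis. (h \<bullet> b) *\<^sub>R b)"
      by (simp add: euclidean_representation)
    also have "\<dots> = h \<bullet> D"
      by (simp add: sum scale D_def inner_sum_right mult.commute)
    finally show "f' h = h \<bullet> D" .
  qed
  have "GDERIV f x :> D"
    using f' unfolding gderiv_def f'_eq .
  moreover have "D' = D" if "GDERIV f x :> D'" for D'
  proof -
    have "(\<lambda>h. h \<bullet> D') = (\<lambda>h. h \<bullet> D)"
      using that \<open>GDERIV f x :> D\<close> unfolding gderiv_def by (rule has_derivative_unique)
    then have "\<forall>h. h \<bullet> D' = h \<bullet> D"
      unfolding fun_eq_iff .
    then show ?thesis
      unfolding vector_eq_ldot .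
  qed
  ultimately show ?thesis
    unfolding gradient_def by (rule theI)
qed

lemma Lp_norm_eq_integral:
  assumes "integrable M (\<lambda>x. \<bar>f x\<bar> powr p)"
  shows "Lp_norm M p f = ennreal ((\<integral>x. \<bar>f x\<bar> powr p \<partial>M) powr (1 / p))"
  using assms by (simp add: Lp_norm_def nn_integral_eq_integral)

lemma DERIV_imp_LIMSEQ:
  assumes "DERIV g 0 :> D" "t \<longlonglongrightarrow> 0" "\<And>n. t n \<noteq> (0::real)"
  shows "(\<lambda>n. (g (t n) - g 0) / t n) \<longlonglongrightarrow> D"
proof -
  have "filterlim t (at 0) sequentially"
    using assms(2,3) by (simp add: filterlim_at)
  then show ?thesis
    using assms(1) unfolding DERIV_def by (auto intro: filterlim_compose)
qed

text \<open>Chain rule along the curve \<open>exp (- t) *\<^sub>R x\<close>, whose velocity at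
  \<open>0\<close> is \<open>- x\<close>; hence the minus sign.\<close>

lemma DERIV_dilate:
  fixes f :: "'a::euclidean_space \<Rightarrow> real"
  assumes "f differentiable at x"
  shows "DERIV (\<lambda>t. dilate (exp (- t)) f x) 0 :> - euler_op f x"
proof -
  have "(f has_derivative (\<lambda>h. h \<bullet> gradient f x)) (at (exp (- 0) *\<^sub>R x))"
    using GDERIV_gradient[OF assms] by (simp add: gderiv_def)
  moreover have "((\<lambda>t::real. exp (- t) *\<^sub>R x) has_derivative (\<lambda>h. (- h) *\<^sub>R x)) (at 0)"
    by (auto intro!: derivative_eq_intros)
  ultimately have "((\<lambda>t. f (exp (- t) *\<^sub>R x)) has_derivative
      (\<lambda>h. ((- h) *\<^sub>R x) \<bullet> gradient f x)) (at 0)"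
    using has_derivative_compose by fastforce
  then show ?thesis
    unfolding has_field_derivative_def dilate_def
    by (rule has_derivative_eq_rhs) (simp add: fun_eq_iff euler_op_def)
qed

text \<open>Bounds the difference quotients in \<open>t\<close> uniformly on the ball. The
  contraction keeps \<open>x\<close> in the ball, so the mean value inequality applies there, and
  \<open>1 - exp (- t) \<le> t\<close>.\<close>

lemma dilate_lipschitz:
  fixes f :: "'a::euclidean_space \<Rightarrow> real"
  assumes diff: "\<And>x. f differentiable at x"
    and L: "\<And>x. norm x \<le> R \<Longrightarrow> norm (gradient f x) \<le> L"
    and "norm x \<le> R" "t \<ge> 0"
  shows "\<bar>dilate (exp (- t)) f x - f x\<bar> \<le> L * R * t"
proof -
  have "0 \<le> L"
    using L[OF assms(3)] norm_ge_zero order_trans by blast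
  have le: "norm (exp (- t) *\<^sub>R x) \<le> R"
    using assms(3,4) mult_mono[of "exp (- t)" 1 "norm x" R] by simp
  have "norm (f (exp (- t) *\<^sub>R x) - f x) \<le> L * norm (exp (- t) *\<^sub>R x - x)"
  proof (rule differentiable_bound[where S = "cball 0 R" and f' = "\<lambda>x h. h \<bullet> gradient f x"])
    fix y :: 'a assume y: "y \<in> cball 0 R"
    show "(f has_derivative (\<lambda>h. h \<bullet> gradient f y)) (at y within cball 0 R)"
      using GDERIV_gradient[OF diff, of y]
      by (simp add: gderiv_def has_derivative_at_withinI)
    show "onorm (\<lambda>h. h \<bullet> gradient f y) \<le> L"
    proof (rule onorm_le)
      fix h
      have "norm (h \<bullet> gradient f y) \<le> norm h * norm (gradient f y)"
        using Cauchy_Schwarz_ineq2 by auto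
      also have "\<dots> \<le> norm h * L"
        using L y by (intro mult_left_mono) auto
      finally show "norm (h \<bullet> gradient f y) \<le> L * norm h" by (simp add: mult.commute)
    qed
  qed (use le assms in auto)
  also have "exp (- t) *\<^sub>R x - x = (exp (- t) - 1) *\<^sub>R x"
    by (simp add: scaleR_left_diff_distrib)
  also have "L * norm \<dots> = L * (norm x * (1 - exp (- t)))"
    using assms(4) by (simp add: abs_minus_commute)
  also have "\<dots> \<le> L * (R * t)"
    using \<open>0 \<le> L\<close> assms(3,4) exp_ge_add_one_self[of "- t"] order_trans[OF norm_ge_zero assms(3)]
    by (intro mult_left_mono mult_mono) auto
  finally show ?thesis by (simp add: dilate_def mult.assoc)
qed

theorem theorem5p2:
  fixes \<mu> :: "(real ^ 'n) measure" and c :: real and f :: "real ^ 'n \<Rightarrow> real"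
  assumes "prob_space \<mu>" and "sets \<mu> = sets borel" and "compact (measure_support \<mu>)"
    and "c > 0" and "strong_hypercontractive \<mu> c"
    and "log_subharmonic f" and "C1 f"
  shows "(\<integral>x. (f x)\<^sup>2 * ln ((f x)\<^sup>2) \<partial>\<mu>)
           - (enn2real (Lp_norm \<mu> 2 f))\<^sup>2 * ln ((enn2real (Lp_norm \<mu> 2 f))\<^sup>2)
         \<le> c * (\<integral>x. f x * euler_op f x \<partial>\<mu>)"
proof -
  interpret prob_space \<mu> by fact
  have f_nonneg: "0 \<le> f x" for x
    using assms(6) by (simp add: log_subharmonic_def)
  have diff: "f differentiable at x" for x
    using assms(7) by (simp add: C1_def)
  have cont_f: "continuous_on A f" for A
    using diff by (meson differentiable_imp_continuous_within continuous_at_imp_continuous_on)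
  have cont_grad: "continuous_on A (gradient f)" for A
    using assms(7) continuous_on_subset unfolding C1_def by blast
  have cont_dil: "continuous_on A (dilate s f)" for s A
    unfolding dilate_def
    by (rule continuous_on_compose2[OF cont_f[of UNIV]]) (auto intro!: continuous_intros)
  have meas_cont: "h \<in> borel_measurable \<mu>" if "continuous_on UNIV h"
    for h :: "real ^ 'n \<Rightarrow> real"
    using borel_measurable_continuous_onI[OF that] measurable_cong_sets[OF assms(2) refl] by blast
  have [measurable]: "f \<in> borel_measurable \<mu>" "dilate s f \<in> borel_measurable \<mu>"
    "euler_op f \<in> borel_measurable \<mu>" for s
    unfolding euler_op_def[abs_def]
    by (intro meas_cont cont_f cont_dil continuous_intros cont_grad)+

  \<comment> \<open>Uniform bounds on a ball carrying the measure\<close>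
  obtain R where R: "R > 0" "\<And>x. x \<in> measure_support \<mu> \<Longrightarrow> norm x \<le> R"
    using compact_imp_bounded[OF assms(3)] by (auto simp: bounded_pos)
  have AE_R: "AE x in \<mu>. norm x \<le> R"
    using AE_measure_support[OF assms(2)] R(2) by auto
  obtain M0 where M0: "\<forall>y\<in>f ` cball 0 R. norm y \<le> M0"
    using compact_imp_bounded[OF compact_continuous_image[OF cont_f compact_cball[of 0 R]]]
    unfolding bounded_iff by blast
  \<comment> \<open>The maximum with \<open>1\<close> makes \<open>M powr a\<close> increasing in
    \<open>a\<close> and meets the hypothesis of \<open>abs_square_mult_ln_le\<close>.\<close>
  define M where "M = max 1 M0"
  have M: "1 \<le> M" "\<And>x. norm x \<le> R \<Longrightarrow> f x \<le> M"
    using M0 f_nonneg by (force simp: M_def)+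
  obtain L where "\<forall>y\<in>gradient f ` cball 0 R. norm y \<le> L"
    using compact_imp_bounded[OF compact_continuous_image[OF cont_grad compact_cball[of 0 R]]]
    unfolding bounded_iff by blast
  then have L: "\<And>x. norm x \<le> R \<Longrightarrow> norm (gradient f x) \<le> L"
    by simp

  \<comment> \<open>Times, critical exponents and difference quotients\<close>
  define t where "t n = inverse (real (Suc n))" for n
  \<comment> \<open>This solves \<open>c * (1 / 2 * ln (q / 2)) = t\<close> for \<open>q\<close>. As
    \<open>t n \<le> 1\<close>, the exponents stay below \<open>2 * exp (2 / c)\<close>.\<close>
  define q where "q n = 2 * exp (2 * t n / c)" for n
  define u where "u n = dilate (exp (- t n)) f" for n
  define N where "N = (\<integral>x. (f x)\<^sup>2 \<partial>\<mu>)"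
  define E where "E = (\<integral>x. (f x)\<^sup>2 * ln (f x) \<partial>\<mu>)"
  define I where "I n = (\<integral>x. f x powr (q n - 1) * ((u n x - f x) / t n) \<partial>\<mu>)" for n
  have t: "0 < t n" "t n \<le> 1" for n
    by (auto simp: t_def field_simps)
  have t_lim: "t \<longlonglongrightarrow> 0"
    unfolding t_def by (rule LIMSEQ_inverse_real_of_nat)
  have q: "2 \<le> q n" "q n \<le> 2 * exp (2 / c)" for n
    using t[of n] assms(4) by (auto simp: q_def divide_right_mono)
  have q_lim: "q \<longlonglongrightarrow> 2"
    unfolding q_def using assms(4) by (auto intro!: tendsto_eq_intros t_lim)
  have [measurable]: "u n \<in> borel_measurable \<mu>" for n
    by (simp add: u_def)
  have u_nonneg: "0 \<le> u n x" for n x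
    by (simp add: u_def dilate_def f_nonneg)
  have u_le: "u n x \<le> M" if "norm x \<le> R" for n x
    using that t[of n] mult_mono[of "exp (- t n)" 1 "norm x" R]
    by (auto simp: u_def dilate_def intro!: M(2))

  \<comment> \<open>Integrability and domination\<close>
  have int_f2: "integrable \<mu> (\<lambda>x. (f x)\<^sup>2)"
    using AE_R by (intro integrable_const_bound[where B = "M\<^sup>2"])
      (auto intro!: power_mono M(2) f_nonneg)
  have int_ln: "integrable \<mu> (\<lambda>x. (f x)\<^sup>2 * ln (f x))"
    using AE_R by (intro integrable_const_bound[where B = "M ^ 3"])
      (auto intro!: abs_square_mult_ln_le M f_nonneg)
  have int_u: "integrable \<mu> (\<lambda>x. u n x powr q n)" for n
    using AE_R q(1)[of n] by (intro integrable_const_bound[where B = "M powr q n"])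
      (auto intro!: powr_mono2 u_nonneg u_le)
  \<comment> \<open>The power of \<open>M\<close> bounds \<open>f x powr (q n - 1)\<close> for all
    \<open>n\<close> at once; \<open>L * R\<close> bounds the difference quotients.\<close>
  define B where "B = M powr (2 * exp (2 / c)) * (L * R)"
  have int_B: "AE x in \<mu>. norm (f x powr (q n - 1) * ((u n x - f x) / t n)) \<le> B" for n
    using AE_R
  proof eventually_elim
    case (elim x)
    have "\<bar>(u n x - f x) / t n\<bar> \<le> L * R"
      using dilate_lipschitz[OF diff L elim, of "t n"] t[of n]
      by (simp add: u_def pos_divide_le_eq)
    moreover have "f x powr (q n - 1) \<le> M powr (q n - 1)"
      using q(1)[of n] M(2)[OF elim] f_nonneg by (intro powr_mono2) auto
    moreover have "M powr (q n - 1) \<le> M powr (2 * exp (2 / c))"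
      using q[of n] M(1) by (intro powr_mono) auto
    ultimately show ?case
      unfolding B_def real_norm_def abs_mult by (intro mult_mono) auto
  qed
  have int_I: "integrable \<mu> (\<lambda>x. f x powr (q n - 1) * ((u n x - f x) / t n))" for n
    using int_B by (rule integrable_const_bound) measurable

  have I_lim: "I \<longlonglongrightarrow> (\<integral>x. f x * - euler_op f x \<partial>\<mu>)"
    unfolding I_def
  proof (rule integral_dominated_convergence[where w = "\<lambda>_. B"])
    show "AE x in \<mu>. (\<lambda>n. f x powr (q n - 1) * ((u n x - f x) / t n))
        \<longlonglongrightarrow> f x * - euler_op f x"
    proof (rule AE_I2, rule tendsto_mult)
      fix x
      show "(\<lambda>n. f x powr (q n - 1)) \<longlonglongrightarrow> f x"
      \<comment> \<open>The limit rule for \<open>powr\<close> needs a nonzero base; at a zero of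
        \<open>f\<close> the sequence is constantly \<open>0\<close>.\<close>
      proof (cases "f x = 0")
        case False
        then have "(\<lambda>n. f x powr (q n - 1)) \<longlonglongrightarrow> f x powr (2 - 1)"
          by (intro tendsto_powr tendsto_intros q_lim)
        then show ?thesis
          using f_nonneg[of x] by simp
      qed simp
      show "(\<lambda>n. (u n x - f x) / t n) \<longlonglongrightarrow> - euler_op f x"
        using DERIV_imp_LIMSEQ[OF DERIV_dilate[OF diff] t_lim] t
        by (simp add: u_def dilate_def less_le)
    qed
  qed (use int_B in auto)

  \<comment> \<open>Upper and lower estimates of the dilated moments\<close>
  have N_nonneg: "0 \<le> N"
    unfolding N_def by simp
  have Lp2: "Lp_norm \<mu> 2 f = ennreal (N powr (1 / 2))"
    using int_f2 Lp_norm_eq_integral[of \<mu> f 2] by (simp add: N_def)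
  have upper: "(\<integral>x. u n x powr q n \<partial>\<mu>) \<le> N powr (q n / 2)" for n
  proof -
    define F where "F = (\<integral>x. u n x powr q n \<partial>\<mu>)"
    have "in_Lp \<mu> 2 f"
      by (simp add: in_Lp_def Lp2)
    moreover have "c * (1 / 2 * ln (q n / 2)) = t n"
      using assms(4) by (simp add: q_def)
    ultimately have "Lp_norm \<mu> (q n) (u n) \<le> Lp_norm \<mu> 2 f"
      using assms(5,6) q(1)[of n] unfolding strong_hypercontractive_def u_def by simp
    then have "F powr (1 / q n) \<le> N powr (1 / 2)"
      using int_u[of n] Lp_norm_eq_integral[of \<mu> "u n" "q n"]
      by (simp add: Lp2 u_nonneg F_def)
    \<comment> \<open>Raising the norm inequality to the power \<open>q n\<close> turns it into one
      between moments.\<close>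
    then have "(F powr (1 / q n)) powr q n \<le> (N powr (1 / 2)) powr q n"
      using q(1)[of n] by (intro powr_mono2) auto
    moreover have "0 \<le> F"
      unfolding F_def by simp
    ultimately show ?thesis
      using q(1)[of n] by (simp add: powr_powr F_def)
  qed
  \<comment> \<open>\<open>powr_ge_tangent\<close> is integrated pointwise; the factor
    \<open>t n\<close> is pulled out of \<open>u n x - f x\<close> so that \<open>I n\<close> has a
    finite limit.\<close>
  have lower: "N + (q n - 2) * E + q n * t n * I n \<le> (\<integral>x. u n x powr q n \<partial>\<mu>)" for n
  proof -
    let ?g = "\<lambda>x. f x powr (q n - 1) * ((u n x - f x) / t n)"
    have "N + (q n - 2) * E + q n * t n * I n
        = (\<integral>x. (f x)\<^sup>2 + (q n - 2) * ((f x)\<^sup>2 * ln (f x)) + q n * t n * ?g x \<partial>\<mu>)"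
      unfolding N_def E_def I_def
      by (simp only: Bochner_Integration.integral_add int_f2 int_ln int_I
          integral_mult_right_zero integrable_mult_right integrable_mult_right_iff
          Bochner_Integration.integrable_add)
    also have "\<dots> \<le> (\<integral>x. u n x powr q n \<partial>\<mu>)"
    proof (rule integral_mono)
      fix x
      show "(f x)\<^sup>2 + (q n - 2) * ((f x)\<^sup>2 * ln (f x)) + q n * t n * ?g x \<le> u n x powr q n"
        using powr_ge_tangent[of "u n x" "f x" "q n", OF u_nonneg f_nonneg q(1)] t[of n] by simp
    qed (intro Bochner_Integration.integrable_add integrable_mult_right int_f2 int_ln int_I int_u)+
    finally show ?thesis .
  qed
  \<comment> \<open>Since \<open>q n / 2 = exp (2 * t n / c)\<close>, the right side is the
    difference quotient at \<open>0\<close> of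
    \<open>\<lambda>s. N powr exp (2 * s / c)\<close>.\<close>
  have ineq: "(q n - 2) / t n * E + q n * I n \<le> (N powr (q n / 2) - N) / t n" for n
  proof -
    have "(q n - 2) / t n * E + q n * I n = ((q n - 2) * E + q n * t n * I n) / t n"
      using t(1)[of n] by (simp add: add_divide_distrib)
    also have "\<dots> \<le> (N powr (q n / 2) - N) / t n"
      using lower[of n] upper[of n] t(1)[of n] by (intro divide_right_mono) auto
    finally show ?thesis .
  qed

  \<comment> \<open>Comparison of the derivatives at time zero\<close>
  have "DERIV (\<lambda>s. 2 * exp (2 * s / c)) 0 :> 4 / c"
    using assms(4) by (auto intro!: derivative_eq_intros)
  from DERIV_imp_LIMSEQ[OF this t_lim] have q'_lim: "(\<lambda>n. (q n - 2) / t n) \<longlonglongrightarrow> 4 / c"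
    using t by (simp add: q_def less_le)
  \<comment> \<open>For \<open>N = 0\<close> the function is constantly \<open>0\<close>, matching
    \<open>N * ln N = 0\<close>.\<close>
  have "DERIV (\<lambda>s. N powr exp (2 * s / c)) 0 :> 2 / c * (N * ln N)"
  proof (cases "N = 0")
    case False
    then show ?thesis
      using N_nonneg assms(4) by (auto intro!: derivative_eq_intros)
  qed simp
  from DERIV_imp_LIMSEQ[OF this t_lim]
  have N_lim: "(\<lambda>n. (N powr (q n / 2) - N) / t n) \<longlonglongrightarrow> 2 / c * (N * ln N)"
    using t N_nonneg by (simp add: q_def less_le)
  have "4 / c * E + 2 * (\<integral>x. f x * - euler_op f x \<partial>\<mu>) \<le> 2 / c * (N * ln N)"
  proof (rule LIMSEQ_le[OF _ N_lim])
    show "(\<lambda>n. (q n - 2) / t n * E + q n * I n)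
        \<longlonglongrightarrow> 4 / c * E + 2 * (\<integral>x. f x * - euler_op f x \<partial>\<mu>)"
      by (intro tendsto_add tendsto_mult tendsto_const q'_lim q_lim I_lim)
  qed (use ineq in blast)
  then have "c / 2 * (4 / c * E + 2 * (\<integral>x. f x * - euler_op f x \<partial>\<mu>))
      \<le> c / 2 * (2 / c * (N * ln N))"
    using assms(4) by (intro mult_left_mono) auto
  then have "2 * E - c * (\<integral>x. f x * euler_op f x \<partial>\<mu>) \<le> N * ln N"
    using assms(4) by (simp add: right_diff_distrib)
  moreover have "(\<integral>x. (f x)\<^sup>2 * ln ((f x)\<^sup>2) \<partial>\<mu>) = 2 * E"
  proof -
    \<comment> \<open>At zeros of \<open>f\<close> the factor \<open>(f x)\<^sup>2\<close> kills
      both sides, which realizes the convention \<open>0 log 0 = 0\<close>.\<close>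
    have "(f x)\<^sup>2 * ln ((f x)\<^sup>2) = 2 * ((f x)\<^sup>2 * ln (f x))" for x
      using f_nonneg[of x] by (cases "f x = 0") (simp_all add: ln_realpow)
    then show ?thesis
      by (simp only: E_def integral_mult_right_zero)
  qed
  moreover have "(enn2real (Lp_norm \<mu> 2 f))\<^sup>2 = N"
    using N_nonneg by (simp add: Lp2 powr_half_sqrt)
  ultimately show ?thesis
    by simp
qed

end
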